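(* Let $\mathfrak{H}$ be a complex Hilbert space, let $\mathfrak{a}$ be a symmetric sesquilinear form with dense domain $\mathrm{Dom}[\mathfrak{a}]\subset\mathfrak{H}$, and let $J$ be a self-adjoint involution on $\mathfrak{H}$ such that $J\,\mathrm{Dom}[\mathfrak{a}]=\mathrm{Dom}[\mathfrak{a}]$ and $\mathfrak{a}[Jx,y]=\mathfrak{a}[x,Jy]$ for all $x,y\in\mathrm{Dom}[\mathfrak{a}]$. Suppose that the form $\mathfrak{a}_J[x,y]:=\mathfrak{a}[x,Jy]$, $x,y\in\mathrm{Dom}[\mathfrak{a}_J]=\mathrm{Dom}[\mathfrak{a}]$, is a positive definite closed form. Put $\mathfrak{H}_\pm=\mathrm{Ran}(I\pm J)$ and let $m_\pm$ be the greatest lower bound of $\mathfrak{a}_J$ restricted to $\mathfrak{H}_\pm$. Let $\mathfrak{v}$ be an $\mathfrak{a}$-bounded symmetric sesquilinear form that is off-diagonal with respect to the orthogonal decomposition $\mathfrak{H}=\mathfrak{H}_+\oplus\mathfrak{H}_-$. On $\mathrm{Dom}[\mathfrak{b}]=\mathrm{Dom}[\mathfrak{a}]$ define the symmetric form $$\mathfrak{b}[x,y]=\mathfrak{a}[x,y]+\mathfrak{v}[x,y],\qquad x,y\in\mathrm{Dom}[\mathfrak{b}].$$ Then: (i) there is a unique self-adjoint operator $B$ in $\mathfrak{H}$ such that $\mathrm{Dom}(B)\subset\mathrm{Dom}[\mathfrak{b}]$ and $$\mathfrak{b}[x,y]=\langle x,By\rangle\quad\text{for all } x\in\mathrm{Dom}[\mathfrak{b}],\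 y\in\mathrm{Dom}(B);$$ (ii) the operator $B$ is boundedly invertible, and the open interval $(-m_-,m_+)\ni 0$ belongs to the resolvent set of $B$.
   Context: Inner products and sesquilinear forms are linear in the second argument and antilinear in the first. A sesquilinear form $\mathfrak{s}$ is symmetric if $\mathfrak{s}[x,y]=\overline{\mathfrak{s}[y,x]}$; $\mathfrak{s}[x]:=\mathfrak{s}[x,x]$. A self-adjoint involution is a bounded operator $J$ with $J=J^*$, $J^2=I$. "Positive definite" for the form $\mathfrak{a}_J$ means that it is symmetric with a strictly positive lower bound: there is $c>0$ with $\mathfrak{a}_J[x]\ge c\|x\|^2$ for all $x\in\mathrm{Dom}[\mathfrak{a}]$. Explicitly, $m_\pm=\inf\{\mathfrak{a}_J[x]: x\in\mathfrak{H}_\pm\cap\mathrm{Dom}[\mathfrak{a}],\ \|x\|=1\}$ (equal to $+\infty$ if $\mathfrak{H}_\pm=\{0\}$). A symmetric sesquilinear form $\mathfrak{v}$ on $\mathrm{Dom}[\mathfrak{v}]\supset\mathrm{Dom}[\mathfrak{a}]$ is off-diagonal with respect to $\mathfrak{H}=\mathfrak{H}_+\oplus\mathfrak{H}_-$ if $\mathfrak{v}[Jx,y]=-\mathfrak{v}[x,Jy]$ for all $x,y\in\mathrm{Dom}[\mathfrak{a}]$. It is an $\mathfrak{a}$-bounded off-diagonal form if, in addition, $$v_0:=\sup_{0\ne x\in\mathrm{Dom}[\mathfrak{a}]}\frac{|\mathfrak{v}[x]|}{\mathfrak{a}_J[x]}<\infty.$$ *)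

theory Defs
  imports "HOL-Analysis.Analysis"
begin

text \<open>
  Inner products and sesquilinear forms are antilinear in the first and linear in the
  second argument.
\<close>

class complex_hilbert_space = banach +
  fixes scaleC :: "complex \<Rightarrow> 'a \<Rightarrow> 'a" (infixr "*\<^sub>C" 75)
    and cinner :: "'a \<Rightarrow> 'a \<Rightarrow> complex"
  assumes scaleC_add_right: "z *\<^sub>C (x + y) = z *\<^sub>C x + z *\<^sub>C y"
    and scaleC_add_left: "(z + w) *\<^sub>C x = z *\<^sub>C x + w *\<^sub>C x"
    and scaleC_scaleC: "z *\<^sub>C w *\<^sub>C x = (z * w) *\<^sub>C x"
    and scaleC_one: "1 *\<^sub>C x = x"
    and scaleR_scaleC: "r *\<^sub>R x = complex_of_real r *\<^sub>C x"
    and cinner_commute: "cinner x y = cnj (cinner y x)"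
    and cinner_add_right: "cinner x (y + y') = cinner x y + cinner x y'"
    and cinner_scaleC_right: "cinner x (z *\<^sub>C y) = z * cinner x y"
    and norm_eq_sqrt_cinner: "norm x = sqrt (Re (cinner x x))"

global_interpretation complex_vector:
  vector_space "scaleC :: complex \<Rightarrow> 'a \<Rightarrow> 'a::complex_hilbert_space"
  by unfold_locales (rule scaleC_add_right scaleC_add_left scaleC_scaleC scaleC_one)+

abbreviation csubspace :: "'a::complex_hilbert_space set \<Rightarrow> bool" where
  "csubspace \<equiv> complex_vector.subspace"


subsection \<open>Sesquilinear forms\<close>

text \<open>
  A form is given by its domain \<open>D\<close> and a function that is only relevant on \<open>D \<times> D\<close>.
\<close>

definition sesquilinear_on ::
    "'a::complex_hilbert_space set \<Rightarrow> ('a \<Rightarrow> 'a \<Rightarrow> complex) \<Rightarrow> bool" where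
  "sesquilinear_on D s \<longleftrightarrow> csubspace D \<and>
    (\<forall>x\<in>D. \<forall>y\<in>D. \<forall>w\<in>D. s x (y + w) = s x y + s x w \<and> s (x + y) w = s x w + s y w) \<and>
    (\<forall>x\<in>D. \<forall>y\<in>D. \<forall>z. s x (z *\<^sub>C y) = z * s x y \<and> s (z *\<^sub>C x) y = cnj z * s x y)"

definition symmetric_form ::
    "'a::complex_hilbert_space set \<Rightarrow> ('a \<Rightarrow> 'a \<Rightarrow> complex) \<Rightarrow> bool" where
  "symmetric_form D s \<longleftrightarrow> sesquilinear_on D s \<and> (\<forall>x\<in>D. \<forall>y\<in>D. s x y = cnj (s y x))"

text \<open>For a symmetric form \<open>s x x\<close> is real, so \<open>Re\<close> loses nothing.\<close>

definition positive_definite_form ::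
    "'a::complex_hilbert_space set \<Rightarrow> ('a \<Rightarrow> 'a \<Rightarrow> complex) \<Rightarrow> bool" where
  "positive_definite_form D s \<longleftrightarrow> symmetric_form D s \<and>
    (\<exists>c>0. \<forall>x\<in>D. Re (s x x) \<ge> c * (norm x)\<^sup>2)"

text \<open>Kato's notion of closedness, meant for forms that are bounded below.\<close>

definition closed_form ::
    "'a::complex_hilbert_space set \<Rightarrow> ('a \<Rightarrow> 'a \<Rightarrow> complex) \<Rightarrow> bool" where
  "closed_form D s \<longleftrightarrow>
    (\<forall>X x. (\<forall>n. X n \<in> D) \<and> X \<longlonglongrightarrow> x \<and>
        ((\<lambda>(m, n). s (X m - X n) (X m - X n)) \<longlongrightarrow> 0) (sequentially \<times>\<^sub>F sequentially)
      \<longrightarrow> x \<in> D \<and> (\<lambda>n. s (X n - x) (X n - x)) \<longlonglongrightarrow> 0)"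

text \<open>The infimum is taken in the extended reals, so it is \<open>\<infinity>\<close> if there is no unit vector.\<close>

definition lower_bound_on ::
    "'a::complex_hilbert_space set \<Rightarrow> 'a set \<Rightarrow> ('a \<Rightarrow> 'a \<Rightarrow> complex) \<Rightarrow> ereal" where
  "lower_bound_on H D s = (INF x\<in>{x \<in> H \<inter> D. norm x = 1}. ereal (Re (s x x)))"

definition relative_bound ::
    "'a::complex_hilbert_space set \<Rightarrow> ('a \<Rightarrow> 'a \<Rightarrow> complex) \<Rightarrow> ('a \<Rightarrow> 'a \<Rightarrow> complex) \<Rightarrow> ereal" where
  "relative_bound D s v = (SUP x\<in>D - {0}. ereal (cmod (v x x) / Re (s x x)))"


definition twisted_form ::
    "('a::complex_hilbert_space \<Rightarrow> 'a) \<Rightarrow> ('a \<Rightarrow> 'a \<Rightarrow> complex) \<Rightarrow> ('a \<Rightarrow> 'a \<Rightarrow> complex)" where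
  "twisted_form J a = (\<lambda>x y. a x (J y))"

definition off_diagonal ::
    "('a::complex_hilbert_space \<Rightarrow> 'a) \<Rightarrow> 'a set \<Rightarrow> ('a \<Rightarrow> 'a \<Rightarrow> complex) \<Rightarrow> bool" where
  "off_diagonal J D v \<longleftrightarrow> (\<forall>x\<in>D. \<forall>y\<in>D. v (J x) y = - v x (J y))"


subsection \<open>Operators\<close>

text \<open>
  A possibly unbounded operator is a partial function, so that equality of operators
  includes equality of their domains.
\<close>

definition linear_operator :: "('a::complex_hilbert_space \<rightharpoonup> 'a) \<Rightarrow> bool" where
  "linear_operator T \<longleftrightarrow> csubspace (dom T) \<and>
    (\<forall>x\<in>dom T. \<forall>y\<in>dom T. the (T (x + y)) = the (T x) + the (T y)) \<and>
    (\<forall>x\<in>dom T. \<forall>z. the (T (z *\<^sub>C x)) = z *\<^sub>C the (T x))"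

text \<open>The vector chosen by \<open>SOME\<close> is unique if the domain of \<open>T\<close> is dense.\<close>

definition op_adjoint :: "('a::complex_hilbert_space \<rightharpoonup> 'a) \<Rightarrow> ('a \<rightharpoonup> 'a)" where
  "op_adjoint T = (\<lambda>y.
     if \<exists>w. \<forall>x\<in>dom T. cinner (the (T x)) y = cinner x w
     then Some (SOME w. \<forall>x\<in>dom T. cinner (the (T x)) y = cinner x w)
     else None)"

definition self_adjoint :: "('a::complex_hilbert_space \<rightharpoonup> 'a) \<Rightarrow> bool" where
  "self_adjoint T \<longleftrightarrow> linear_operator T \<and> closure (dom T) = UNIV \<and> op_adjoint T = T"

definition bounded_clinear :: "('a::complex_hilbert_space \<Rightarrow> 'a) \<Rightarrow> bool" where
  "bounded_clinear R \<longleftrightarrow>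
    Vector_Spaces.linear scaleC scaleC R \<and> (\<exists>K. \<forall>x. norm (R x) \<le> K * norm x)"

definition self_adjoint_involution :: "('a::complex_hilbert_space \<Rightarrow> 'a) \<Rightarrow> bool" where
  "self_adjoint_involution J \<longleftrightarrow>
    bounded_clinear J \<and> self_adjoint (\<lambda>x. Some (J x)) \<and> (\<forall>x. J (J x) = x)"

definition boundedly_invertible :: "('a::complex_hilbert_space \<rightharpoonup> 'a) \<Rightarrow> bool" where
  "boundedly_invertible T \<longleftrightarrow>
    (\<exists>R. bounded_clinear R \<and> (\<forall>y. T (R y) = Some y) \<and> (\<forall>x\<in>dom T. R (the (T x)) = x))"

definition op_minus_scalar ::
    "('a::complex_hilbert_space \<rightharpoonup> 'a) \<Rightarrow> complex \<Rightarrow> ('a \<rightharpoonup> 'a)" where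
  "op_minus_scalar T z = (\<lambda>x. map_option (\<lambda>y. y - z *\<^sub>C x) (T x))"

definition resolvent_set :: "('a::complex_hilbert_space \<rightharpoonup> 'a) \<Rightarrow> complex set" where
  "resolvent_set T = {z. boundedly_invertible (op_minus_scalar T z)}"

definition represents_form ::
    "('a::complex_hilbert_space \<rightharpoonup> 'a) \<Rightarrow> 'a set \<Rightarrow> ('a \<Rightarrow> 'a \<Rightarrow> complex) \<Rightarrow> bool" where
  "represents_form B D b \<longleftrightarrow> self_adjoint B \<and> dom B \<subseteq> D \<and>
    (\<forall>x\<in>D. \<forall>y\<in>dom B. b x y = cinner x (the (B y)))"

end

(* The twisted form b[J x, y] - l <J x, y> is coercive for l in (-m_-, m_+): off-diagonality makes
   v[J x, x] purely imaginary, and a_J[x] - l <J x, x> splits along x + J x and x - J x into two parts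
   bounded below by means of m_+ and m_-. Hence Lax-Milgram on the Hilbert space (Dom[a], a_J) yields a
   bounded solution operator R_l of b[x, y] - l <x, y> = <x, f>. The operator B is the inverse of R_0,
   and it is the only one because self-adjoint operators have no proper self-adjoint extension. *)

theory Submission
  imports Defs
begin

text \<open>In general \<open>b\<close> is not bounded below, so no shift makes it positive and the
  representation theorem for semibounded forms does not apply. The twist by \<open>J\<close> is the
  substitute: the real part of \<open>b (J x) x\<close> is exactly a_J[x]. The perturbation costs no
  positivity, whatever its size; its relative bound enters only the continuity estimate, which is
  why the interval does not depend on \<open>v\<close>.

  The endpoints come from the components x_+ and x_- of x: a_J[x] is the sum of a_J[x_+] and
  a_J[x_-], while <J x, x> is the difference of their squared norms. So \<open>l\<close> competes
  with m_+ on H_+, and \<open>- l\<close> competes with m_- on H_-.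

  The price of the twist is that \<open>b (J x) y\<close> is no longer Hermitian, hence Lax-Milgram
  instead of Riesz. The untwisted form is still symmetric, and this makes R_0 symmetric and its
  inverse self-adjoint.\<close>

section \<open>Algebra of sesquilinear forms\<close>

locale sesquilinear_form =
  fixes D :: "'a::complex_hilbert_space set" and s :: "'a \<Rightarrow> 'a \<Rightarrow> complex"
  assumes sesquilinear: "sesquilinear_on D s"
begin

lemma subspace: "csubspace D"
  using sesquilinear by (simp add: sesquilinear_on_def)

lemma zero_mem: "0 \<in> D"
  using subspace by (rule complex_vector.subspace_0)

lemma add_mem: "x \<in> D \<Longrightarrow> y \<in> D \<Longrightarrow> x + y \<in> D"
  using subspace by (rule complex_vector.subspace_add)

lemma diff_mem: "x \<in> D \<Longrightarrow> y \<in> D \<Longrightarrow> x - y \<in> D"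
  using subspace by (rule complex_vector.subspace_diff)

lemma scale_mem: "x \<in> D \<Longrightarrow> z *\<^sub>C x \<in> D"
  using subspace by (rule complex_vector.subspace_scale)

lemma scaleR_mem: "x \<in> D \<Longrightarrow> r *\<^sub>R x \<in> D"
  by (simp add: scaleR_scaleC scale_mem)

lemmas mem = zero_mem add_mem diff_mem scale_mem scaleR_mem

lemma add_right: "x \<in> D \<Longrightarrow> y \<in> D \<Longrightarrow> w \<in> D \<Longrightarrow> s x (y + w) = s x y + s x w"
  and add_left: "x \<in> D \<Longrightarrow> y \<in> D \<Longrightarrow> w \<in> D \<Longrightarrow> s (x + y) w = s x w + s y w"
  and scale_right: "x \<in> D \<Longrightarrow> y \<in> D \<Longrightarrow> s x (z *\<^sub>C y) = z * s x y"
  and scale_left: "x \<in> D \<Longrightarrow> y \<in> D \<Longrightarrow> s (z *\<^sub>C x) y = cnj z * s x y"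
  using sesquilinear by (simp_all add: sesquilinear_on_def)

lemma scaleR_right: "x \<in> D \<Longrightarrow> y \<in> D \<Longrightarrow> s x (r *\<^sub>R y) = of_real r * s x y"
  and scaleR_left: "x \<in> D \<Longrightarrow> y \<in> D \<Longrightarrow> s (r *\<^sub>R x) y = of_real r * s x y"
  by (simp_all add: scaleR_scaleC scale_right scale_left)

lemma diff_right: "x \<in> D \<Longrightarrow> y \<in> D \<Longrightarrow> w \<in> D \<Longrightarrow> s x (y - w) = s x y - s x w"
  and diff_left: "x \<in> D \<Longrightarrow> y \<in> D \<Longrightarrow> w \<in> D \<Longrightarrow> s (x - y) w = s x w - s y w"
  using add_right[of x y "(-1) *\<^sub>R w"] add_left[of x "(-1) *\<^sub>R y" w]
    scaleR_right[of x w "-1"] scaleR_left[of y w "-1"] scaleR_mem[of _ "-1"]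
  by simp_all

lemma zero_right: "x \<in> D \<Longrightarrow> s x 0 = 0"
  and zero_left: "x \<in> D \<Longrightarrow> s 0 x = 0"
  using scaleR_right[of x 0 0] scaleR_left[of 0 x 0] by (simp_all add: zero_mem)

lemmas sesq = add_right add_left scale_right scale_left scaleR_right scaleR_left
  diff_right diff_left zero_right zero_left

end

section \<open>Complete inner products on a subspace, Riesz and Lax-Milgram\<close>

text \<open>
  A Hilbert space structure on a subspace \<open>D\<close>: besides the ambient space itself, this covers
  its closed subspaces and the domain of a closed positive definite form.
\<close>

locale complete_form = sesquilinear_form +
  assumes hermitian: "x \<in> D \<Longrightarrow> y \<in> D \<Longrightarrow> s x y = cnj (s y x)"
    and positive: "x \<in> D \<Longrightarrow> x \<noteq> 0 \<Longrightarrow> Re (s x x) > 0"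
    and complete: "(\<And>n::nat. X n \<in> D) \<Longrightarrow>
      (\<And>e. e > 0 \<Longrightarrow> \<exists>N. \<forall>m\<ge>N. \<forall>n\<ge>N. Re (s (X m - X n) (X m - X n)) < e) \<Longrightarrow>
      \<exists>x\<in>D. (\<lambda>n. Re (s (X n - x) (X n - x))) \<longlonglongrightarrow> 0"
begin

abbreviation q :: "'a \<Rightarrow> real" where "q x \<equiv> Re (s x x)"

lemma q_nonneg: "x \<in> D \<Longrightarrow> q x \<ge> 0"
  using positive[of x] zero_right[of 0] zero_mem by (cases "x = 0") auto

lemma q_eq_0: "x \<in> D \<Longrightarrow> q x = 0 \<Longrightarrow> x = 0"
  using positive[of x] by force

lemma Re_commute: "x \<in> D \<Longrightarrow> y \<in> D \<Longrightarrow> Re (s x y) = Re (s y x)"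
  using hermitian[of x y] by simp

lemma q_add: "x \<in> D \<Longrightarrow> y \<in> D \<Longrightarrow> q (x + y) = q x + 2 * Re (s x y) + q y"
  and q_diff: "x \<in> D \<Longrightarrow> y \<in> D \<Longrightarrow> q (x - y) = q x - 2 * Re (s x y) + q y"
  using Re_commute[of x y] by (simp_all add: mem sesq)

lemma q_scale: "x \<in> D \<Longrightarrow> q (z *\<^sub>C x) = (cmod z)\<^sup>2 * q x"
  and q_scaleR: "x \<in> D \<Longrightarrow> q (r *\<^sub>R x) = r\<^sup>2 * q x"
proof -
  assume x: "x \<in> D"
  have "s (z *\<^sub>C x) (z *\<^sub>C x) = of_real ((cmod z)\<^sup>2) * s x x"
    using x complex_norm_square[of z] by (simp add: mem sesq mult_ac)
  then show "q (z *\<^sub>C x) = (cmod z)\<^sup>2 * q x" by simp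
  show "q (r *\<^sub>R x) = r\<^sup>2 * q x" using x by (simp add: mem sesq power2_eq_square)
qed

text \<open>Polarisation; for \<open>v = s\<close> and \<open>M = 1\<close> this is the Cauchy-Schwarz inequality.\<close>

lemma symmetric_form_bound:
  assumes v: "symmetric_form D v" and M: "\<And>x. x \<in> D \<Longrightarrow> cmod (v x x) \<le> M * q x"
    and x: "x \<in> D" and y: "y \<in> D"
  shows "cmod (v x y) \<le> M * sqrt (q x) * sqrt (q y)"
proof -
  interpret v: sesquilinear_form D v
    using v by unfold_locales (simp add: symmetric_form_def)
  have herm: "v u w = cnj (v w u)" if "u \<in> D" "w \<in> D" for u w
    using v that unfolding symmetric_form_def by blast
  have re: "2 * Re (v u w) \<le> M * (q u + q w)" if u: "u \<in> D" and w: "w \<in> D" for u w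
  proof -
    have "Re (v w u) = Re (v u w)" using herm[OF w u] by simp
    then have "4 * Re (v u w) = Re (v (u + w) (u + w)) - Re (v (u - w) (u - w))"
      using u w by (simp add: v.mem v.sesq)
    also have "\<dots> \<le> M * q (u + w) + M * q (u - w)"
      using M[OF add_mem[OF u w]] M[OF diff_mem[OF u w]]
        complex_Re_le_cmod[of "v (u + w) (u + w)"] abs_Re_le_cmod[of "v (u - w) (u - w)"]
      by linarith
    also have "\<dots> = 2 * (M * (q u + q w))"
      by (simp add: q_add[OF u w] q_diff[OF u w] algebra_simps)
    finally show ?thesis by simp
  qed
  show ?thesis
  proof (cases "x = 0 \<or> y = 0 \<or> v x y = 0")
    case True
    \<comment> \<open>No sign is assumed for \<open>M\<close>: it is nonnegative as soon as
      \<open>x\<close> is nonzero, and for \<open>x = 0\<close> both sides of the claim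
      vanish.\<close>
    have "0 \<le> M * q x" using M[OF x] norm_ge_zero order_trans by blast
    then have "x = 0 \<or> M \<ge> 0" using positive[OF x] by (auto simp: zero_le_mult_iff)
    then show ?thesis
      using True x y q_nonneg by (auto simp: v.zero_left v.zero_right zero_left zero_right)
  next
    case False
    \<comment> \<open>Scaling both vectors to \<open>q\<close>-length one balances the two terms of
      \<open>re\<close>, and rotating by the phase \<open>z\<close> makes the value of
      \<open>v\<close> real and positive; \<open>re\<close> then reads
      \<open>2 * cmod (v x y) / (p * r) \<le> 2 * M\<close>.\<close>
    define p r where "p = sqrt (q x)" and "r = sqrt (q y)"
    have pr: "p > 0" "r > 0" "p\<^sup>2 = q x" "r\<^sup>2 = q y"
      using False positive[OF x] positive[OF y] by (simp_all add: p_def r_def)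
    define z where "z = cnj (v x y) / of_real (cmod (v x y))"
    have "cnj (v x y) * v x y = of_real (cmod (v x y)) * of_real (cmod (v x y))"
      using complex_norm_square[of "v x y"] by (simp add: power2_eq_square mult.commute)
    then have z: "z * v x y = of_real (cmod (v x y))" "cmod z = 1"
      using False by (simp_all add: z_def norm_divide)
    have "2 * Re (v ((1/p) *\<^sub>R x) ((1/r) *\<^sub>R z *\<^sub>C y)) \<le> M * (q ((1/p) *\<^sub>R x) + q ((1/r) *\<^sub>R z *\<^sub>C y))"
      by (intro re mem x y)
    also have "v ((1/p) *\<^sub>R x) ((1/r) *\<^sub>R z *\<^sub>C y) = of_real (cmod (v x y) / (p * r))"
      using x y z by (simp add: v.mem v.sesq)
    also have "q ((1/p) *\<^sub>R x) + q ((1/r) *\<^sub>R z *\<^sub>C y) = 2"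
      using x y z False q_eq_0 pr by (auto simp: q_scaleR q_scale mem power_divide)
    finally show ?thesis
      using pr by (simp add: field_simps flip: p_def r_def)
  qed
qed

lemma symmetric: "symmetric_form D s"
  unfolding symmetric_form_def using sesquilinear hermitian by blast

lemma Cauchy_Schwarz: "x \<in> D \<Longrightarrow> y \<in> D \<Longrightarrow> cmod (s x y) \<le> sqrt (q x) * sqrt (q y)"
proof -
  have "cmod (s x x) \<le> 1 * q x" if "x \<in> D" for x
  proof -
    have "Im (s x x) = 0" using hermitian[OF that that] by (simp add: complex_eq_iff)
    then show ?thesis using q_nonneg[OF that] by (simp add: cmod_def)
  qed
  from symmetric_form_bound[OF symmetric this] show "x \<in> D \<Longrightarrow> y \<in> D \<Longrightarrow> ?thesis" by simp
qed

lemma eq_zeroI: "x \<in> D \<Longrightarrow> (\<And>u. u \<in> D \<Longrightarrow> s u x = 0) \<Longrightarrow> x = 0"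
  using q_eq_0 by force

text \<open>Minimise \<open>q x - 2 * Re (\<phi> x)\<close>; by the parallelogram law minimising sequences are Cauchy.\<close>

theorem Riesz_representation:
  assumes add: "\<And>x y. x \<in> D \<Longrightarrow> y \<in> D \<Longrightarrow> \<phi> (x + y) = \<phi> x + \<phi> y"
    and scale: "\<And>x z. x \<in> D \<Longrightarrow> \<phi> (z *\<^sub>C x) = cnj z * \<phi> x"
    and bound: "\<And>x. x \<in> D \<Longrightarrow> cmod (\<phi> x) \<le> K * sqrt (q x)"
  shows "\<exists>y\<in>D. \<forall>x\<in>D. s x y = \<phi> x"
proof -
  define Q where "Q x = q x - 2 * Re (\<phi> x)" for x
  have scaleR: "\<phi> (r *\<^sub>R x) = of_real r * \<phi> x" if "x \<in> D" for x r
    using scale[OF that, of "of_real r"] by (simp add: scaleR_scaleC)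
  have lower: "Q x \<ge> - K\<^sup>2" if "x \<in> D" for x
  proof -
    have "Re (\<phi> x) \<le> K * sqrt (q x)"
      using bound[OF that] complex_Re_le_cmod order_trans by blast
    moreover have "0 \<le> (sqrt (q x) - K)\<^sup>2" by simp
    then have "2 * (K * sqrt (q x)) \<le> q x + K\<^sup>2"
      using q_nonneg[OF that] by (simp add: power2_diff mult.commute mult.left_commute)
    ultimately show ?thesis unfolding Q_def by linarith
  qed
  have bdd: "bdd_below (Q ` D)" using lower by (intro bdd_belowI2)
  define m where "m = Inf (Q ` D)"
  have m: "m \<le> Q x" if "x \<in> D" for x
    unfolding m_def by (intro cINF_lower bdd that)
  have "\<exists>x\<in>D. Q x < m + 1 / real (Suc n)" for n
    using cINF_less_iff[OF _ bdd, of "m + 1 / real (Suc n)"] zero_mem by (auto simp: m_def)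
  then obtain X where X: "\<And>n. X n \<in> D" and QX: "\<And>n. Q (X n) < m + 1 / real (Suc n)"
    by metis
  have parallelogram: "q (x - y) \<le> 2 * (Q x - m) + 2 * (Q y - m)" if x: "x \<in> D" and y: "y \<in> D" for x y
  proof -
    have "4 * m \<le> 4 * Q ((1/2) *\<^sub>R (x + y))" by (simp add: m mem x y del: scaleR_add_right)
    also have "\<dots> = q (x + y) - 4 * Re (\<phi> (x + y))"
      unfolding Q_def q_scaleR[OF add_mem[OF x y]] scaleR[OF add_mem[OF x y]]
      by (simp add: power_divide)
    finally have "4 * m \<le> q x + 2 * Re (s x y) + q y - 4 * (Re (\<phi> x) + Re (\<phi> y))"
      unfolding q_add[OF x y] add[OF x y] plus_complex.simps .
    then show ?thesis unfolding Q_def q_diff[OF x y] by (simp add: algebra_simps)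
  qed
  have "\<exists>x\<in>D. (\<lambda>n. q (X n - x)) \<longlonglongrightarrow> 0"
  proof (rule complete[OF X])
    fix e :: real assume "e > 0"
    \<comment> \<open>The parallelogram estimate weighs each of two excesses over \<open>m\<close>
      by 2, hence the share \<open>e / 4\<close>.\<close>
    then obtain N where N: "1 / real (Suc N) < e / 4"
      using nat_approx_posE[of "e/4"] by auto
    have "q (X i - X j) < e" if "i \<ge> N" "j \<ge> N" for i j
    proof -
      have "1 / real (Suc k) \<le> 1 / real (Suc N)" if "k \<ge> N" for k
        using that by (simp add: frac_le)
      from this[OF that(1)] this[OF that(2)] show ?thesis
        using parallelogram[OF X[of i] X[of j]] QX[of i] QX[of j] N by argo
    qed
    then show "\<exists>N. \<forall>i\<ge>N. \<forall>j\<ge>N. q (X i - X j) < e" by blast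
  qed
  then obtain y where y: "y \<in> D" and lim: "(\<lambda>n. q (X n - y)) \<longlonglongrightarrow> 0" by blast
  have re: "Re (s h y) = Re (\<phi> h)" if h: "h \<in> D" for h
  proof -
    have "(\<lambda>n. sqrt (q h) * sqrt (q (X n - y))) \<longlonglongrightarrow> 0"
      using tendsto_mult_left[OF tendsto_real_sqrt[OF lim]] by simp
    moreover have "cmod (s h (X n) - s h y) \<le> sqrt (q h) * sqrt (q (X n - y))" for n
      using Cauchy_Schwarz[OF h diff_mem[OF X[of n] y]] by (simp add: diff_right h X y)
    ultimately have "(\<lambda>n. s h (X n) - s h y) \<longlonglongrightarrow> 0"
      using Lim_null_comparison[of "\<lambda>n. s h (X n) - s h y" "\<lambda>n. sqrt (q h) * sqrt (q (X n - y))"]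
      by simp
    then have sX: "(\<lambda>n. s h (X n)) \<longlonglongrightarrow> s h y" by (rule LIM_zero_cancel)
    \<comment> \<open>The variation in direction \<open>h\<close> is taken at \<open>X n\<close>,
      where \<open>Q\<close> exceeds \<open>m\<close> by less than \<open>1 / real (Suc n)\<close>.
      The limit gives the variational inequality at \<open>y\<close> directly, bypassing
      \<open>Q y = m\<close>.\<close>
    have ineq: "0 \<le> 2 * t * (Re (s h y) - Re (\<phi> h)) + t\<^sup>2 * q h" for t
    proof (rule LIMSEQ_le_const)
      have "(\<lambda>n. 2 * t * (Re (s h (X n)) - Re (\<phi> h)) + t\<^sup>2 * q h)
          \<longlonglongrightarrow> 2 * t * (Re (s h y) - Re (\<phi> h)) + t\<^sup>2 * q h"
        by (intro tendsto_intros sX)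
      from tendsto_add[OF LIMSEQ_inverse_real_of_nat this]
      show "(\<lambda>n. 1 / real (Suc n) + (2 * t * (Re (s h (X n)) - Re (\<phi> h)) + t\<^sup>2 * q h))
          \<longlonglongrightarrow> 2 * t * (Re (s h y) - Re (\<phi> h)) + t\<^sup>2 * q h"
        by (simp only: inverse_eq_divide add_0)
      have "0 \<le> 1 / real (Suc n) + (2 * t * (Re (s h (X n)) - Re (\<phi> h)) + t\<^sup>2 * q h)" for n
      proof -
        have "Q (X n + t *\<^sub>R h) = Q (X n) + (2 * t * (Re (s h (X n)) - Re (\<phi> h)) + t\<^sup>2 * q h)"
          using h X[of n] Re_commute[OF h X[of n]]
          by (simp add: Q_def q_add mem add scaleR scaleR_right scaleR_left power2_eq_square algebra_simps)
        moreover have "m \<le> Q (X n + t *\<^sub>R h)" by (intro m mem h X)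
        ultimately show ?thesis using QX[of n] by linarith
      qed
      then show "\<exists>N. \<forall>n\<ge>N. 0 \<le> 1 / real (Suc n) + (2 * t * (Re (s h (X n)) - Re (\<phi> h)) + t\<^sup>2 * q h)"
        by blast
    qed
    define d where "d = Re (s h y) - Re (\<phi> h)"
    \<comment> \<open>The quadratic in \<open>t\<close> has its minimum at \<open>- d / q h\<close>;
      adding 1 to the denominator avoids division by zero and still leaves a strictly negative value
      unless \<open>d = 0\<close>.\<close>
    define k where "k = q h + 1"
    have k: "k > 0" using q_nonneg[OF h] by (simp add: k_def)
    have "0 \<le> (2 * (- d / k) * d + (- d / k)\<^sup>2 * q h) * k\<^sup>2"
      using ineq[of "- d / k"] by (simp add: d_def)
    also have "\<dots> = - (d\<^sup>2 * (2 * k - q h))"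
      using k by (simp add: field_simps power2_eq_square)
    finally have "d\<^sup>2 * (q h + 2) \<le> 0" by (simp add: k_def algebra_simps)
    then have "d = 0" using q_nonneg[OF h] by (simp add: mult_le_0_iff)
    then show ?thesis by (simp add: d_def)
  qed
  \<comment> \<open>The imaginary part is the real identity at
    \<open>\<i> *\<^sub>C x\<close>.\<close>
  have "s x y = \<phi> x" if x: "x \<in> D" for x
    using re[OF x] re[OF scale_mem[OF x, of \<i>]] x y
    by (simp add: complex_eq_iff scale scale_left)
  with y show ?thesis by blast
qed

text \<open>
  With \<open>T\<close> representing \<open>t\<close> with respect to \<open>s\<close>, apply the Riesz representation once more to the
  equivalent inner product \<open>s (T x) (T y)\<close>: this solves the equation tested with \<open>T x\<close>, and
  by coercivity the residual \<open>r\<close> vanishes, as it is orthogonal to \<open>T r\<close>.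
\<close>

theorem Lax_Milgram:
  assumes t: "sesquilinear_on D t"
    and bounded: "\<And>x y. x \<in> D \<Longrightarrow> y \<in> D \<Longrightarrow> cmod (t x y) \<le> M * sqrt (q x) * sqrt (q y)"
    and coercive: "\<And>x. x \<in> D \<Longrightarrow> Re (t x x) \<ge> e * q x" and e: "e > 0"
    and add: "\<And>x y. x \<in> D \<Longrightarrow> y \<in> D \<Longrightarrow> \<phi> (x + y) = \<phi> x + \<phi> y"
    and scale: "\<And>x z. x \<in> D \<Longrightarrow> \<phi> (z *\<^sub>C x) = cnj z * \<phi> x"
    and bound: "\<And>x. x \<in> D \<Longrightarrow> cmod (\<phi> x) \<le> K * sqrt (q x)"
  shows "\<exists>y\<in>D. \<forall>x\<in>D. t x y = \<phi> x"
proof -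
  interpret t: sesquilinear_form D t by unfold_locales (fact t)
  have "\<exists>w\<in>D. \<forall>x\<in>D. s x w = t x y" if "y \<in> D" for y
    by (rule Riesz_representation[where K = "M * sqrt (q y)"])
      (use that bounded in \<open>auto simp: t.sesq mult_ac\<close>)
  then obtain T where T: "\<And>y. y \<in> D \<Longrightarrow> T y \<in> D" "\<And>x y. x \<in> D \<Longrightarrow> y \<in> D \<Longrightarrow> s x (T y) = t x y"
    by metis
  have T_eqI: "T y = w" if "y \<in> D" "w \<in> D" "\<And>x. x \<in> D \<Longrightarrow> t x y = s x w" for y w
    using eq_zeroI[of "T y - w"] that T by (auto simp: mem sesq)
  have T_add: "T (x + y) = T x + T y" and T_diff: "T (x - y) = T x - T y"
    if "x \<in> D" "y \<in> D" for x y
    by (rule T_eqI; use that T in \<open>simp add: mem sesq t.sesq\<close>)+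
  have T_scale: "T (z *\<^sub>C x) = z *\<^sub>C T x" if "x \<in> D" for x z
    by (rule T_eqI; use that T in \<open>simp add: mem sesq t.sesq\<close>)
  have lower: "e * sqrt (q x) \<le> sqrt (q (T x))" if x: "x \<in> D" for x
  proof (cases "x = 0")
    case True
    then show ?thesis using T[OF x] by (simp add: q_nonneg zero_right zero_mem)
  next
    case False
    have "e * q x \<le> cmod (s x (T x))"
      using coercive[OF x] complex_Re_le_cmod[of "t x x"] T(2)[OF x x] by simp
    also have "\<dots> \<le> sqrt (q x) * sqrt (q (T x))" by (intro Cauchy_Schwarz x T)
    finally have "(e * sqrt (q x)) * sqrt (q x) \<le> sqrt (q (T x)) * sqrt (q x)"
      using q_nonneg[OF x] by (simp add: mult.commute mult.left_commute)
    then show ?thesis using positive[OF x False] by simp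
  qed
  have upper: "sqrt (q (T x)) \<le> M * sqrt (q x)" if x: "x \<in> D" for x
  proof (cases "T x = 0")
    case True
    have "0 \<le> M * q x" using bounded[OF x x] norm_ge_zero[of "t x x"] q_nonneg[OF x] 
      by (metis mult.assoc order_trans real_sqrt_mult_self abs_of_nonneg)
    then have "0 \<le> M * sqrt (q x)"
      using q_nonneg[OF x] by (auto simp: zero_le_mult_iff)
    then show ?thesis using True by (simp add: zero_right zero_mem)
  next
    case False
    have "q (T x) \<le> cmod (t (T x) x)"
      using T(1)[OF x] T(2)[OF T(1)[OF x] x] complex_Re_le_cmod[of "s (T x) (T x)"] by simp
    also have "\<dots> \<le> M * sqrt (q (T x)) * sqrt (q x)" by (intro bounded x T)
    finally have "sqrt (q (T x)) * sqrt (q (T x)) \<le> (M * sqrt (q x)) * sqrt (q (T x))"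
      using q_nonneg[OF T(1)[OF x]] by (simp add: mult_ac)
    moreover have "sqrt (q (T x)) > 0" using positive[OF T(1)[OF x] False] by simp
    ultimately show ?thesis by (rule mult_right_le_imp_le)
  qed
  have lower2: "e\<^sup>2 * q x \<le> q (T x)" if x: "x \<in> D" for x
    using power_mono[OF lower[OF x], of 2] e q_nonneg x T(1) by (simp add: power_mult_distrib)
  have upper2: "q (T x) \<le> M\<^sup>2 * q x" if x: "x \<in> D" for x
    using power_mono[OF upper[OF x], of 2] q_nonneg x T(1) by (simp add: power_mult_distrib)
  \<comment> \<open>Completeness is inherited because the two quadratic forms are equivalent:
    \<open>lower2\<close> turns Cauchy sequences for \<open>q (T x)\<close> into Cauchy sequences
    for \<open>q x\<close>, and \<open>upper2\<close> carries the convergence back.\<close>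
  interpret T: complete_form D "\<lambda>x y. s (T x) (T y)"
  proof
    show "sesquilinear_on D (\<lambda>x y. s (T x) (T y))"
      using T by (auto simp: sesquilinear_on_def subspace T_add T_scale sesq)
    show "s (T x) (T y) = cnj (s (T y) (T x))" if "x \<in> D" "y \<in> D" for x y
      using that by (intro hermitian T)
    show "q (T x) > 0" if "x \<in> D" "x \<noteq> 0" for x
      using lower2[OF that(1)] positive[OF that] e by (meson mult_pos_pos less_le_trans zero_less_power)
    fix X :: "nat \<Rightarrow> 'a"
    assume X: "\<And>n. X n \<in> D"
      and Cauchy: "\<And>d. d > 0 \<Longrightarrow> \<exists>N. \<forall>m\<ge>N. \<forall>n\<ge>N. q (T (X m - X n)) < d"
    have "\<exists>x\<in>D. (\<lambda>n. q (X n - x)) \<longlonglongrightarrow> 0"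
    proof (rule complete[OF X])
      fix d :: real assume "d > 0"
      then obtain N where N: "\<forall>m\<ge>N. \<forall>n\<ge>N. q (T (X m - X n)) < e\<^sup>2 * d"
        using Cauchy[of "e\<^sup>2 * d"] e by auto
      have "e\<^sup>2 * q (X m - X n) < e\<^sup>2 * d" if "m \<ge> N" "n \<ge> N" for m n
        using N that lower2[OF diff_mem[OF X X]] by (meson order_le_less_trans)
      then show "\<exists>N. \<forall>m\<ge>N. \<forall>n\<ge>N. q (X m - X n) < d" using e by auto
    qed
    then obtain x where x: "x \<in> D" and lim: "(\<lambda>n. q (X n - x)) \<longlonglongrightarrow> 0" by blast
    have "(\<lambda>n. q (T (X n - x))) \<longlonglongrightarrow> 0"
    proof (rule tendsto_sandwich[OF _ _ tendsto_const])
      show "(\<lambda>n. M\<^sup>2 * q (X n - x)) \<longlonglongrightarrow> 0" using tendsto_mult_left[OF lim, of "M\<^sup>2"] by simp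
    qed (auto intro!: always_eventually upper2 q_nonneg T mem X x)
    with x show "\<exists>x\<in>D. (\<lambda>n. q (T (X n - x))) \<longlonglongrightarrow> 0" by blast
  qed
  have "\<exists>y\<in>D. \<forall>x\<in>D. s (T x) (T y) = \<phi> (T x)"
  proof (rule T.Riesz_representation)
    fix x assume "x \<in> D"
    then show "cmod (\<phi> (T x)) \<le> K * sqrt (q (T x))" by (intro bound T)
  qed (auto simp: T_add T_scale T add scale)
  then obtain y where y: "y \<in> D" and T_y: "\<And>x. x \<in> D \<Longrightarrow> s (T x) (T y) = \<phi> (T x)"
    by blast
  have "\<exists>w\<in>D. \<forall>x\<in>D. s x w = \<phi> x"
    using add scale bound by (rule Riesz_representation)
  then obtain w where w: "w \<in> D" and w_rep: "\<And>x. x \<in> D \<Longrightarrow> s x w = \<phi> x" by blast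
  define r where "r = T y - w"
  have r: "r \<in> D" by (simp add: r_def mem y w T)
  have "s (T r) r = 0"
    using T_y[OF r] w_rep[OF T(1)[OF r]] T(1)[OF r] T(1)[OF y] w by (simp add: r_def diff_right)
  then have "t r r = 0" using T[OF r] r hermitian[of r "T r"] by simp
  then have "q r = 0"
    using coercive[OF r] e q_nonneg[OF r] by (simp add: mult_le_0_iff)
  then have "T y = w" using q_eq_0[OF r] by (simp add: r_def)
  then have "\<forall>x\<in>D. t x y = \<phi> x" using T(2)[OF _ y] w_rep by metis
  with y show ?thesis by blast
qed

end

section \<open>The ambient inner product, orthogonality and density\<close>

text \<open>Cauchy sequences converge in the ambient Banach space, and closedness keeps the limit in
  \<open>S\<close>. The case of the closure of a subspace makes the Riesz representation available
  there as an orthogonal projection.\<close>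

lemma hilbert_form:
  fixes S :: "'a::complex_hilbert_space set"
  assumes S: "csubspace S" "closed S"
  shows "complete_form S cinner"
proof
  have add_left: "cinner (x + y) w = cinner x w + cinner y w" for x y w :: 'a
    using cinner_commute[of "x + y" w] cinner_commute[of x w] cinner_commute[of y w]
    by (simp only: cinner_add_right complex_cnj_add)
  have scale_left: "cinner (z *\<^sub>C x) y = cnj z * cinner x y" for x y :: 'a and z
    using cinner_commute[of "z *\<^sub>C x" y] cinner_commute[of x y]
    by (simp only: cinner_scaleC_right complex_cnj_mult)
  show "sesquilinear_on S cinner"
    using S(1) by (simp add: sesquilinear_on_def cinner_add_right cinner_scaleC_right add_left scale_left)
  show "cinner x y = cnj (cinner y x)" for x y :: 'a by (rule cinner_commute)
  have norm_sq: "Re (cinner x x) = (norm x)\<^sup>2" for x :: 'a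
    using norm_ge_zero[of x] unfolding norm_eq_sqrt_cinner by (simp add: real_sqrt_ge_0_iff)
  show "Re (cinner x x) > 0" if "x \<noteq> 0" for x :: 'a
    using that by (simp add: norm_sq)
  fix X :: "nat \<Rightarrow> 'a"
  assume X: "\<And>n. X n \<in> S"
    and C: "\<And>e. e > 0 \<Longrightarrow> \<exists>N. \<forall>m\<ge>N. \<forall>n\<ge>N. Re (cinner (X m - X n) (X m - X n)) < e"
  have "Cauchy X"
  proof (rule CauchyI)
    fix e :: real assume e: "e > 0"
    then obtain N where N: "\<forall>m\<ge>N. \<forall>n\<ge>N. (norm (X m - X n))\<^sup>2 < e\<^sup>2"
      using C[of "e\<^sup>2"] by (auto simp: norm_sq)
    then show "\<exists>N. \<forall>m\<ge>N. \<forall>n\<ge>N. norm (X m - X n) < e"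
      using e by (meson power_less_imp_less_base less_imp_le)
  qed
  then obtain x where x: "X \<longlonglongrightarrow> x" using Cauchy_convergent_iff convergent_def by blast
  moreover have "x \<in> S" using S(2) X x closed_sequentially by blast
  moreover have "(\<lambda>n. (norm (X n - x))\<^sup>2) \<longlonglongrightarrow> (norm (x - x))\<^sup>2"
    by (intro tendsto_intros x)
  ultimately show "\<exists>x\<in>S. (\<lambda>n. Re (cinner (X n - x) (X n - x))) \<longlonglongrightarrow> 0"
    by (auto simp: norm_sq)
qed

interpretation hilbert: complete_form "UNIV :: 'a::complex_hilbert_space set" cinner
  by (rule hilbert_form) (auto simp: complex_vector.subspace_UNIV)

lemma Re_cinner_self: "Re (cinner x x) = (norm x)\<^sup>2"
  for x :: "'a::complex_hilbert_space"
  using hilbert.q_nonneg[of x] by (simp add: norm_eq_sqrt_cinner)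

lemma cmod_cinner_le: "cmod (cinner x y) \<le> norm x * norm y"
  for x y :: "'a::complex_hilbert_space"
  using hilbert.Cauchy_Schwarz[of x y] by (simp add: norm_eq_sqrt_cinner)

lemma cinner_limit_zero:
  fixes x :: "'a::complex_hilbert_space"
  assumes "x \<in> closure S" and "\<And>y. y \<in> S \<Longrightarrow> cinner y w = 0"
  shows "cinner x w = 0"
proof -
  obtain X where X: "\<And>n. X n \<in> S" "X \<longlonglongrightarrow> x"
    using assms(1) by (auto simp: closure_sequential)
  have "(\<lambda>n. norm (x - X n) * norm w) \<longlonglongrightarrow> norm (x - x) * norm w"
    by (intro tendsto_intros X)
  moreover have "cmod (cinner x w) \<le> norm (x - X n) * norm w" for n
    using cmod_cinner_le[of "x - X n" w] assms(2)[OF X(1)] by (simp add: hilbert.diff_left)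
  ultimately have "cmod (cinner x w) \<le> 0"
    by (intro LIMSEQ_le_const[of "\<lambda>n. norm (x - X n) * norm w"]) auto
  then show ?thesis by simp
qed

lemma dense_orthogonal_eq_0:
  fixes w :: "'a::complex_hilbert_space"
  assumes "closure S = UNIV" and "\<And>y. y \<in> S \<Longrightarrow> cinner y w = 0"
  shows "w = 0"
  using cinner_limit_zero[of w S w] assms hilbert.q_eq_0[of w] by simp

lemma csubspace_closure:
  fixes S :: "'a::complex_hilbert_space set"
  assumes S: "csubspace S"
  shows "csubspace (closure S)"
  unfolding complex_vector.subspace_def
proof (intro conjI ballI allI)
  show "0 \<in> closure S" using S closure_subset complex_vector.subspace_0 by blast
next
  fix x y assume "x \<in> closure S" "y \<in> closure S"
  then obtain X Y where X: "\<And>n. X n \<in> S" "X \<longlonglongrightarrow> x" and Y: "\<And>n. Y n \<in> S" "Y \<longlonglongrightarrow> y"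
    by (auto simp: closure_sequential)
  have "(\<lambda>n. X n + Y n) \<longlonglongrightarrow> x + y" by (intro tendsto_intros X Y)
  moreover have "X n + Y n \<in> S" for n by (intro complex_vector.subspace_add S X Y)
  ultimately show "x + y \<in> closure S" unfolding closure_sequential by (auto intro!: exI[of _ "\<lambda>n. X n + Y n"])
next
  fix x z assume "x \<in> closure S"
  then obtain X where X: "\<And>n. X n \<in> S" "X \<longlonglongrightarrow> x"
    by (auto simp: closure_sequential)
  have norm_scale: "norm (z *\<^sub>C u) = cmod z * norm u" for u :: 'a
    by (simp add: norm_eq_sqrt_cinner hilbert.q_scale real_sqrt_mult)
  have "(\<lambda>n. cmod z * norm (X n - x)) \<longlonglongrightarrow> cmod z * norm (x - x)" by (intro tendsto_intros X)
  then have "(\<lambda>n. norm (z *\<^sub>C X n - z *\<^sub>C x)) \<longlonglongrightarrow> 0"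
    by (simp add: norm_scale flip: complex_vector.scale_right_diff_distrib)
  then have "(\<lambda>n. z *\<^sub>C X n) \<longlonglongrightarrow> z *\<^sub>C x"
    by (simp add: LIM_zero_iff tendsto_norm_zero_iff)
  moreover have "z *\<^sub>C X n \<in> S" for n by (intro complex_vector.subspace_scale S X)
  ultimately show "z *\<^sub>C x \<in> closure S" unfolding closure_sequential by (auto intro!: exI[of _ "\<lambda>n. z *\<^sub>C X n"])
qed

text \<open>Riesz representation of \<open>\<lambda>x. cinner x u\<close> inside
  \<open>closure S\<close> yields the orthogonal projection \<open>y\<close> of \<open>u\<close>.
  Then \<open>u - y\<close> is orthogonal to \<open>S\<close>, hence zero, and \<open>u\<close> lies
  in the closure.\<close>

lemma dense_if_orthogonal_trivial:
  fixes S :: "'a::complex_hilbert_space set"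
  assumes S: "csubspace S" and trivial: "\<And>w. (\<And>y. y \<in> S \<Longrightarrow> cinner y w = 0) \<Longrightarrow> w = 0"
  shows "closure S = UNIV"
proof -
  interpret complete_form "closure S" cinner
    by (intro hilbert_form csubspace_closure S closed_closure)
  have "u \<in> closure S" for u
  proof -
    have "\<exists>y\<in>closure S. \<forall>x\<in>closure S. cinner x y = cinner x u"
      by (rule Riesz_representation[where K = "norm u"])
        (use cmod_cinner_le[of _ u] in
          \<open>auto simp: hilbert.add_left hilbert.scale_left Re_cinner_self mult.commute\<close>)
    then obtain y where y: "y \<in> closure S" "\<And>x. x \<in> closure S \<Longrightarrow> cinner x y = cinner x u"
      by blast
    have "u - y = 0"
      by (rule trivial) (use y closure_subset[of S] in \<open>auto simp: hilbert.diff_right\<close>)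
    with y show ?thesis by simp
  qed
  then show ?thesis by blast
qed

section \<open>Adjoints and self-adjoint operators\<close>

text \<open>Two candidates differ by a vector orthogonal to a dense set, so the choice by
  \<open>SOME\<close> is forced.\<close>

lemma op_adjoint_eq_Some:
  assumes dense: "closure (dom T) = UNIV"
  shows "op_adjoint T y = Some w \<longleftrightarrow> (\<forall>x\<in>dom T. cinner (the (T x)) y = cinner x w)"
    (is "_ \<longleftrightarrow> ?P w")
proof
  assume "op_adjoint T y = Some w"
  then have "\<exists>w. ?P w" and "w = (SOME w. ?P w)"
    unfolding op_adjoint_def by (auto split: if_splits)
  then show "?P w" using someI_ex[of ?P] by blast
next
  assume w: "?P w"
  have "w' = w" if "?P w'" for w'
    using dense_orthogonal_eq_0[OF dense, of "w' - w"] that w by (simp add: hilbert.diff_right)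
  then have "(SOME w. ?P w) = w" using w by (intro some_equality) auto
  then show "op_adjoint T y = Some w" using w unfolding op_adjoint_def by auto
qed

text \<open>Taking adjoints reverses inclusion: if \<open>B\<close> extends \<open>A\<close>, then
  \<open>A\<close>, being its own adjoint, extends the adjoint of \<open>B\<close>, which is
  \<open>B\<close>.\<close>

lemma self_adjoint_maximal:
  assumes A: "self_adjoint A" and B: "self_adjoint B" and sub: "A \<subseteq>\<^sub>m B"
  shows "A = B"
proof (rule map_le_antisym[OF sub])
  have dense: "closure (dom A) = UNIV" "closure (dom B) = UNIV"
    and adj: "op_adjoint A = A" "op_adjoint B = B"
    using A B by (simp_all add: self_adjoint_def)
  show "B \<subseteq>\<^sub>m A"
  proof (unfold map_le_def, intro ballI)
    fix y assume "y \<in> dom B"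
    then obtain w where w: "B y = Some w" by blast
    then have "\<forall>x\<in>dom B. cinner (the (B x)) y = cinner x w"
      using op_adjoint_eq_Some[OF dense(2)] adj by metis
    then have "\<forall>x\<in>dom A. cinner (the (A x)) y = cinner x w"
      using sub by (metis domIff map_le_def)
    then have "A y = Some w"
      using op_adjoint_eq_Some[OF dense(1)] adj by metis
    with w show "B y = A y" by simp
  qed
qed

section \<open>The operator represented by a uniquely solvable form\<close>

text \<open>The assumption on \<open>R\<close> encodes existence and uniqueness of weak solutions at
  once. Density of \<open>D\<close> makes \<open>R\<close> injective; \<open>R\<close> is symmetric
  and defined everywhere, so its range is dense and its inverse is self-adjoint. Any representing
  operator is a restriction of this inverse, because each of its pairs solves the weak equation, and
  maximality gives equality.\<close>

lemma representing_operator: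
  fixes D :: "'a::complex_hilbert_space set"
  assumes h: "symmetric_form D h" and dense: "closure D = UNIV"
    and R: "\<And>f y. R f = y \<longleftrightarrow> y \<in> D \<and> (\<forall>x\<in>D. h x y = cinner x f)"
  shows "represents_form B D h \<longleftrightarrow> (\<forall>y f. B y = Some f \<longleftrightarrow> y = R f)"
    and "\<exists>!B. represents_form B D h"
proof -
  interpret h: sesquilinear_form D h
    using h by unfold_locales (simp add: symmetric_form_def)
  have h_commute: "h x y = cnj (h y x)" if "x \<in> D" "y \<in> D" for x y
    using h that unfolding symmetric_form_def by blast
  have R_mem: "R f \<in> D" and R_rep: "\<And>x. x \<in> D \<Longrightarrow> h x (R f) = cinner x f" for f
    using R by blast+
  have R_add: "R (f + g) = R f + R g" for f g
    unfolding R by (simp add: R_mem R_rep h.mem h.sesq hilbert.add_right)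
  have R_scale: "R (z *\<^sub>C f) = z *\<^sub>C R f" for z f
    unfolding R by (simp add: R_mem R_rep h.mem h.sesq hilbert.scale_right)
  \<comment> \<open>Both sides equal \<open>h (R f) (R g)\<close>, the right one through the
    symmetry of \<open>h\<close>.\<close>
  have R_symmetric: "cinner (R f) g = cinner f (R g)" for f g
    using R_rep[OF R_mem, of f g] R_rep[OF R_mem, of g f] h_commute[OF R_mem R_mem, of f g]
      cinner_commute[of f "R g"] by simp
  have R_inj: "f = g" if "R f = R g" for f g
    using dense_orthogonal_eq_0[OF dense, of "f - g"] R_rep[of _ f] R_rep[of _ g] that
    by (simp add: hilbert.diff_right)
  have range: "csubspace (range R)"
  proof (rule complex_vector.subspaceI)
    show "0 \<in> range R" using R_scale[of 0 0] by (metis complex_vector.scale_zero_left rangeI)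
  qed (auto simp flip: R_add R_scale)
  have range_dense: "closure (range R) = UNIV"
  proof (rule dense_if_orthogonal_trivial[OF range])
    fix w assume "\<And>y. y \<in> range R \<Longrightarrow> cinner y w = 0"
    then have "cinner f (R w) = 0" for f using R_symmetric by (metis rangeI)
    then have "R w = 0" using hilbert.eq_zeroI[of "R w"] by simp
    also have "0 = R 0" using R_scale[of 0 0] by simp
    finally show "w = 0" by (rule R_inj)
  qed
  have represents: "represents_form B D h" if B: "\<forall>y f. B y = Some f \<longleftrightarrow> y = R f" for B
  proof -
    have B_R: "B (R f) = Some f" for f using B by simp
    have dom: "dom B = range R" using B by (auto simp: dom_def)
    have "linear_operator B"
      unfolding linear_operator_def dom
      by (auto simp: range B_R simp flip: R_add R_scale)
    \<comment> \<open>With \<open>x = R f\<close> running through the domain, the adjoint condition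
      is \<open>cinner f y = cinner (R f) w\<close>; symmetry of \<open>R\<close> moves it to
      \<open>w\<close>, and \<open>f\<close> is arbitrary.\<close>
    moreover have "op_adjoint B y = Some w \<longleftrightarrow> B y = Some w" for y w
    proof -
      have "op_adjoint B y = Some w \<longleftrightarrow> (\<forall>f. cinner f y = cinner f (R w))"
        by (subst op_adjoint_eq_Some) (simp_all add: dom range_dense B_R R_symmetric)
      also have "\<dots> \<longleftrightarrow> y = R w"
        using hilbert.eq_zeroI[of "y - R w"] by (auto simp: hilbert.diff_right)
      finally show ?thesis using B by simp
    qed
    then have "op_adjoint B = B" by (metis ext option.exhaust)
    ultimately show ?thesis
      unfolding represents_form_def self_adjoint_def
      by (auto simp: dom range_dense B_R R_mem R_rep)
  qed
  define B0 where "B0 y = (if y \<in> range R then Some (inv R y) else None)" for y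
  have "inv R (R f) = f" for f using R_inj by (intro inv_f_f injI)
  then have B0: "\<forall>y f. B0 y = Some f \<longleftrightarrow> y = R f" by (auto simp: B0_def)
  have unique: "B = B0" if B: "represents_form B D h" for B
  proof -
    have "B \<subseteq>\<^sub>m B0"
    proof (unfold map_le_def, intro ballI)
      fix y assume y: "y \<in> dom B"
      then obtain f where f: "B y = Some f" by blast
      have "R f = y" unfolding R using B y f by (auto simp: represents_form_def)
      then show "B y = B0 y" using B0 f by metis
    qed
    then show ?thesis
      using B represents[OF B0] by (intro self_adjoint_maximal) (auto simp: represents_form_def)
  qed
  show "represents_form B D h \<longleftrightarrow> (\<forall>y f. B y = Some f \<longleftrightarrow> y = R f)"
    using represents unique B0 by blast
  show "\<exists>!B. represents_form B D h"
    using represents[OF B0] unique by blast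
qed

section \<open>Lower bounds and twisted coercivity\<close>

text \<open>Homogeneity extends the bound from unit vectors to the cone \<open>H\<close>. A real
  \<open>p\<close> strictly below the infimum also covers an infinite infimum.\<close>

lemma (in complete_form) lower_bound_onD:
  assumes x: "x \<in> H" "x \<in> D" and cone: "\<And>x r. x \<in> H \<Longrightarrow> r *\<^sub>R x \<in> H"
    and p: "ereal p < lower_bound_on H D s"
  shows "p * (norm x)\<^sup>2 \<le> q x"
proof (cases "x = 0")
  case False
  define u where "u = (1 / norm x) *\<^sub>R x"
  have "u \<in> {x \<in> H \<inter> D. norm x = 1}" using False x by (simp add: u_def cone mem)
  then have "lower_bound_on H D s \<le> ereal (q u)"
    unfolding lower_bound_on_def by (rule INF_lower)
  then have "p \<le> q u" using p by (metis ereal_less_eq(3) less_imp_le order_trans)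
  also have "q u = q x / (norm x)\<^sup>2" using x by (simp add: u_def q_scaleR power_divide)
  finally show ?thesis using False by (simp add: field_simps)
qed (simp add: q_nonneg zero_mem)

text \<open>
  The symmetric form \<open>h\<close> need not be semibounded, but testing with \<open>J x\<close> in place of \<open>x\<close> makes it coercive.
\<close>

lemma (in complete_form) twisted_coercive_solution:
  assumes h: "symmetric_form D h"
    and bounded: "\<And>x. x \<in> D \<Longrightarrow> cmod (h x x) \<le> M * q x"
    and coercive: "\<And>x. x \<in> D \<Longrightarrow> Re (h (J x) x) \<ge> e * q x" and e: "e > 0"
    and embedding: "\<And>x. x \<in> D \<Longrightarrow> q x \<ge> c * (norm x)\<^sup>2" and c: "c > 0"
    and J_D: "\<And>x. x \<in> D \<Longrightarrow> J x \<in> D" and J_J: "\<And>x. J (J x) = x"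
    and J_add: "\<And>x y. J (x + y) = J x + J y" and J_scale: "\<And>z x. J (z *\<^sub>C x) = z *\<^sub>C J x"
    and J_norm: "\<And>x. norm (J x) = norm x" and J_q: "\<And>x. x \<in> D \<Longrightarrow> q (J x) = q x"
  shows "\<exists>R. bounded_clinear R \<and> (\<forall>f y. R f = y \<longleftrightarrow> y \<in> D \<and> (\<forall>x\<in>D. h x y = cinner x f))"
proof -
  interpret h: sesquilinear_form D h
    using h by unfold_locales (simp add: symmetric_form_def)
  have norm_le: "norm x \<le> 1 / sqrt c * sqrt (q x)" if "x \<in> D" for x
    using real_sqrt_le_mono[OF embedding[OF that]] c by (simp add: real_sqrt_mult field_simps)
  have "\<exists>y\<in>D. \<forall>x\<in>D. h x y = cinner x f" for f
  proof -
    \<comment> \<open>As \<open>J\<close> is an involution of \<open>D\<close>, the vectors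
      \<open>J x\<close> exhaust all test vectors, so this is the original equation in a coercive
      guise.\<close>
    have "\<exists>y\<in>D. \<forall>x\<in>D. h (J x) y = cinner (J x) f"
    proof (rule Lax_Milgram[where t = "\<lambda>x y. h (J x) y" and \<phi> = "\<lambda>x. cinner (J x) f" and e = e])
      show "sesquilinear_on D (\<lambda>x y. h (J x) y)"
        by (auto simp: sesquilinear_on_def subspace J_D J_add J_scale h.sesq)
      show "cmod (h (J x) y) \<le> M * sqrt (q x) * sqrt (q y)" if "x \<in> D" "y \<in> D" for x y
        using symmetric_form_bound[OF h bounded J_D that(2)] that by (simp add: J_q)
      show "cmod (cinner (J x) f) \<le> (norm f / sqrt c) * sqrt (q x)" if "x \<in> D" for x
        using cmod_cinner_le[of "J x" f] mult_right_mono[OF norm_le[OF that], of "norm f"]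
        by (simp add: J_norm mult.commute)
    qed (simp_all add: coercive e J_add J_scale hilbert.add_left hilbert.scale_left)
    then show ?thesis using J_D J_J by metis
  qed
  then obtain R where R: "\<And>f. R f \<in> D" "\<And>f x. x \<in> D \<Longrightarrow> h x (R f) = cinner x f" by metis
  have R_eqI: "R f = y" if "y \<in> D" "\<And>x. x \<in> D \<Longrightarrow> h x y = cinner x f" for f y
  proof -
    have d: "R f - y \<in> D" by (intro mem R that)
    have "h (J (R f - y)) (R f - y) = 0" using that R J_D[OF d] by (simp add: h.diff_right)
    then have "q (R f - y) = 0"
      using coercive[OF d] e q_nonneg[OF d] by (simp add: mult_le_0_iff)
    then show ?thesis using q_eq_0[OF d] by simp
  qed
  have "R (f + g) = R f + R g" for f g
    by (rule R_eqI) (simp_all add: R mem h.sesq hilbert.add_right)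
  moreover have "R (z *\<^sub>C f) = z *\<^sub>C R f" for z f
    by (rule R_eqI) (simp_all add: R mem h.sesq hilbert.scale_right)
  ultimately have "Vector_Spaces.linear scaleC scaleC R" by unfold_locales
  \<comment> \<open>Testing the equation for \<open>R f\<close> with \<open>J (R f)\<close> bounds
    \<open>e * c * (norm (R f))\<^sup>2\<close> by \<open>norm (R f) * norm f\<close>; one factor
    cancels.\<close>
  moreover have "norm (R f) \<le> 1 / (e * c) * norm f" for f
  proof (cases "norm (R f) = 0")
    case False
    have "e * (c * (norm (R f))\<^sup>2) \<le> e * q (R f)"
      using embedding[OF R(1)] e by simp
    also have "\<dots> \<le> Re (cinner (J (R f)) f)" using coercive[OF R(1)[of f]] R J_D by simp
    also have "\<dots> \<le> norm (R f) * norm f"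
      using complex_Re_le_cmod cmod_cinner_le[of "J (R f)" f] order_trans by (fastforce simp: J_norm)
    finally have "norm (R f) * (e * c * norm (R f)) \<le> norm (R f) * norm f"
      by (simp add: power2_eq_square mult_ac)
    then have "e * c * norm (R f) \<le> norm f" using False by simp
    then show ?thesis using e c by (simp add: field_simps)
  qed (use e c in simp)
  ultimately have "bounded_clinear R" unfolding bounded_clinear_def by blast
  then show ?thesis using R R_eqI by blast
qed

section \<open>Involutions, closed forms and relative bounds\<close>

lemma self_adjoint_involutionD:
  fixes J :: "'a::complex_hilbert_space \<Rightarrow> 'a"
  assumes "self_adjoint_involution J"
  shows "J (J x) = x" and "J (x + y) = J x + J y" and "J (z *\<^sub>C x) = z *\<^sub>C J x"
    and "cinner (J x) y = cinner x (J y)" and "norm (J x) = norm x"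
proof -
  show JJ: "J (J x) = x" for x using assms by (simp add: self_adjoint_involution_def)
  have "Vector_Spaces.linear scaleC scaleC J"
    using assms by (simp add: self_adjoint_involution_def bounded_clinear_def)
  then interpret J: Vector_Spaces.linear scaleC scaleC J .
  show "J (x + y) = J x + J y" "J (z *\<^sub>C x) = z *\<^sub>C J x" by (rule J.add J.scale)+
  have "op_adjoint (\<lambda>x. Some (J x)) = (\<lambda>x. Some (J x))"
    using assms by (simp add: self_adjoint_involution_def self_adjoint_def)
  then have "op_adjoint (\<lambda>x. Some (J x)) y = Some (J y)" for y by metis
  then show sym: "cinner (J x) y = cinner x (J y)" for x y
    by (subst (asm) op_adjoint_eq_Some) (auto simp: dom_def)
  show "norm (J x) = norm x" by (simp add: norm_eq_sqrt_cinner sym JJ)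
qed

text \<open>Closedness speaks only about sequences that already converge in norm. The positive lower
  bound supplies this: a sequence that is Cauchy for the form is Cauchy in norm, and its norm limit
  is the one that closedness places in \<open>D\<close>.\<close>

lemma complete_form_if_closed:
  fixes D :: "'a::complex_hilbert_space set"
  assumes pos: "positive_definite_form D s" and closed: "closed_form D s"
  shows "complete_form D s"
proof
  obtain c where c: "c > 0" and lower: "\<And>x. x \<in> D \<Longrightarrow> Re (s x x) \<ge> c * (norm x)\<^sup>2"
    using pos by (auto simp: positive_definite_form_def)
  have sym: "symmetric_form D s" using pos by (simp add: positive_definite_form_def)
  show sesq: "sesquilinear_on D s" using sym by (simp add: symmetric_form_def)
  interpret sesquilinear_form D s by unfold_locales (fact sesq)
  show herm: "s x y = cnj (s y x)" if "x \<in> D" "y \<in> D" for x y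
    using sym that unfolding symmetric_form_def by blast
  have s_real: "s x x = of_real (Re (s x x))" if "x \<in> D" for x
    using herm[OF that that] by (simp add: complex_eq_iff)
  show "Re (s x x) > 0" if "x \<in> D" "x \<noteq> 0" for x
    using lower[OF that(1)] that c by (meson less_le_trans mult_pos_pos zero_less_norm_iff zero_less_power)
  fix X :: "nat \<Rightarrow> 'a"
  assume X: "\<And>n. X n \<in> D"
    and C: "\<And>e. e > 0 \<Longrightarrow> \<exists>N. \<forall>m\<ge>N. \<forall>n\<ge>N. Re (s (X m - X n) (X m - X n)) < e"
  have "Cauchy X"
  proof (rule CauchyI)
    fix e :: real assume e: "e > 0"
    obtain N where N: "\<forall>m\<ge>N. \<forall>n\<ge>N. Re (s (X m - X n) (X m - X n)) < c * e\<^sup>2"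
      using C[of "c * e\<^sup>2"] c e by auto
    have "norm (X m - X n) < e" if "m \<ge> N" "n \<ge> N" for m n
    proof -
      have "c * (norm (X m - X n))\<^sup>2 < c * e\<^sup>2"
        using lower[OF diff_mem[OF X[of m] X[of n]]] N that by (meson order_le_less_trans)
      then show ?thesis using c e by (meson mult_less_cancel_left_pos power_less_imp_less_base less_imp_le)
    qed
    then show "\<exists>N. \<forall>m\<ge>N. \<forall>n\<ge>N. norm (X m - X n) < e" by blast
  qed
  then obtain x where x: "X \<longlonglongrightarrow> x" using Cauchy_convergent_iff convergent_def by blast
  have "((\<lambda>(m, n). s (X m - X n) (X m - X n)) \<longlongrightarrow> 0) (sequentially \<times>\<^sub>F sequentially)"
  proof (rule tendstoI)
    fix e :: real assume "e > 0"
    then obtain N where N: "\<forall>m\<ge>N. \<forall>n\<ge>N. Re (s (X m - X n) (X m - X n)) < e" using C by blast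
    have "cmod (s (X m - X n) (X m - X n)) < e" if "m \<ge> N" "n \<ge> N" for m n
    proof -
      have d: "X m - X n \<in> D" by (intro mem X)
      have "0 \<le> Re (s (X m - X n) (X m - X n))"
        using lower[OF d] c by (meson less_imp_le mult_nonneg_nonneg order_trans zero_le_power2)
      then have "cmod (s (X m - X n) (X m - X n)) = Re (s (X m - X n) (X m - X n))"
        by (subst s_real[OF d]) simp
      then show ?thesis using N that by simp
    qed
    then show "\<forall>\<^sub>F p in sequentially \<times>\<^sub>F sequentially.
        dist (case p of (m, n) \<Rightarrow> s (X m - X n) (X m - X n)) 0 < e"
      unfolding eventually_prod_sequentially by auto
  qed
  with closed X x have "x \<in> D" "(\<lambda>n. s (X n - x) (X n - x)) \<longlonglongrightarrow> 0"
    unfolding closed_form_def by blast+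
  then show "\<exists>x\<in>D. (\<lambda>n. Re (s (X n - x) (X n - x))) \<longlonglongrightarrow> 0"
    using tendsto_Re by fastforce
qed

lemma symmetric_form_subset:
  "symmetric_form D' v \<Longrightarrow> csubspace D \<Longrightarrow> D \<subseteq> D' \<Longrightarrow> symmetric_form D v"
  unfolding symmetric_form_def sesquilinear_on_def by (meson subsetD)

lemma relative_boundE:
  assumes "relative_bound D s v < \<infinity>"
  obtains M where "\<And>x. x \<in> D \<Longrightarrow> x \<noteq> 0 \<Longrightarrow> cmod (v x x) / Re (s x x) \<le> M"
proof -
  \<comment> \<open>A real number strictly above the supremum, since the supremum itself is minus
    infinity when \<open>D\<close> is trivial.\<close>
  obtain M where M: "relative_bound D s v < ereal M"
    using assms ereal_dense2 by blast
  have "cmod (v x x) / Re (s x x) \<le> M" if "x \<in> D" "x \<noteq> 0" for x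
  proof -
    have "ereal (cmod (v x x) / Re (s x x)) \<le> relative_bound D s v"
      unfolding relative_bound_def using that by (intro SUP_upper) auto
    then show ?thesis using M by (metis ereal_less_eq(3) less_imp_le order_trans)
  qed
  then show ?thesis using that by blast
qed

section \<open>The operator \<open>B\<close> and its spectral gap\<close>

theorem theorem2p4:
  fixes D Dv :: "'a::complex_hilbert_space set"
    and a v b :: "'a \<Rightarrow> 'a \<Rightarrow> complex"
    and J :: "'a \<Rightarrow> 'a"
    and m_plus m_minus :: ereal
  assumes a_symmetric: "symmetric_form D a"
    and D_dense: "closure D = UNIV"
    and J_involution: "self_adjoint_involution J"
    and J_D: "J ` D = D"
    and a_J_commute: "\<And>x y. x \<in> D \<Longrightarrow> y \<in> D \<Longrightarrow> a (J x) y = a x (J y)"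
    and aJ_positive: "positive_definite_form D (twisted_form J a)"
    and aJ_closed: "closed_form D (twisted_form J a)"
    and m_plus: "m_plus = lower_bound_on (range (\<lambda>x. x + J x)) D (twisted_form J a)"
    and m_minus: "m_minus = lower_bound_on (range (\<lambda>x. x - J x)) D (twisted_form J a)"
    and D_Dv: "D \<subseteq> Dv"
    and v_symmetric: "symmetric_form Dv v"
    and v_off_diagonal: "off_diagonal J D v"
    and v_bounded: "relative_bound D (twisted_form J a) v < \<infinity>"
    and b: "\<And>x y. x \<in> D \<Longrightarrow> y \<in> D \<Longrightarrow> b x y = a x y + v x y"
  shows "(\<exists>!B. represents_form B D b) \<and>
    - m_minus < 0 \<and> 0 < m_plus \<and>
    (\<forall>B. represents_form B D b \<longrightarrow>
       boundedly_invertible B \<and>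
       complex_of_real ` {l. - m_minus < ereal l \<and> ereal l < m_plus} \<subseteq> resolvent_set B)"
proof -
  define s where "s = twisted_form J a"
  have s: "s x y = a x (J y)" for x y by (simp add: s_def twisted_form_def)
  note J = self_adjoint_involutionD[OF J_involution]
  interpret complete_form D s
    unfolding s_def using aJ_positive aJ_closed by (rule complete_form_if_closed)
  interpret a: sesquilinear_form D a
    using a_symmetric by unfold_locales (simp add: symmetric_form_def)
  obtain c where c: "c > 0" and lower: "\<And>x. x \<in> D \<Longrightarrow> q x \<ge> c * (norm x)\<^sup>2"
    using aJ_positive by (auto simp: positive_definite_form_def s_def)
  have J_mem: "J x \<in> D" if "x \<in> D" for x using J_D that by blast
  have q_J: "q (J x) = q x" if "x \<in> D" for x
    using a_J_commute[OF that J_mem[OF that]] a_J_commute[OF that that] that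
    by (simp add: s J)
  have v: "symmetric_form D v"
    using v_symmetric subspace D_Dv by (rule symmetric_form_subset)
  interpret v: sesquilinear_form D v
    using v by unfold_locales (simp add: symmetric_form_def)
  obtain M where M: "\<And>x. x \<in> D \<Longrightarrow> x \<noteq> 0 \<Longrightarrow> cmod (v x x) / q x \<le> M"
    using v_bounded relative_boundE unfolding s_def by blast
  have v_le: "cmod (v x x) \<le> M * q x" if "x \<in> D" for x
  proof (cases "x = 0")
    case False
    then show ?thesis
      using M[OF that False] positive[OF that False] by (metis pos_divide_le_eq)
  qed (simp add: v.zero_left zero_left zero_mem)
  have b_symmetric: "symmetric_form D (\<lambda>x y. b x y - of_real l * cinner x y)" for l
  proof -
    have a_v: "a x y = cnj (a y x)" "v x y = cnj (v y x)" if "x \<in> D" "y \<in> D" for x y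
      using a_symmetric v that unfolding symmetric_form_def by blast+
    have "b x y - of_real l * cinner x y = cnj (b y x - of_real l * cinner y x)"
      if "x \<in> D" "y \<in> D" for x y
      using that a_v[OF that] cinner_commute[of x y] by (simp add: b)
    moreover have "sesquilinear_on D (\<lambda>x y. b x y - of_real l * cinner x y)"
      by (simp add: sesquilinear_on_def subspace b mem a.sesq v.sesq hilbert.sesq algebra_simps)
    ultimately show ?thesis unfolding symmetric_form_def by blast
  qed
  have b_bounded: "cmod (b x x - of_real l * cinner x x) \<le> (1 + M + \<bar>l\<bar> / c) * q x"
    if x: "x \<in> D" for x l
  proof -
    \<comment> \<open>Cauchy-Schwarz for \<open>s\<close> and \<open>q (J x) = q x\<close> dominate
      \<open>a\<close> by \<open>s\<close> with constant 1; the other summands of the bound come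
      from \<open>v\<close> and from the embedding with constant \<open>c\<close>.\<close>
    have "a x x = s x (J x)" by (simp add: s J)
    then have "cmod (a x x) \<le> q x"
      using Cauchy_Schwarz[OF x J_mem[OF x]] q_nonneg[OF x] by (simp add: q_J x)
    moreover have "c * cmod (cinner x x) \<le> q x"
      using mult_left_mono[OF cmod_cinner_le[of x x] less_imp_le[OF c]] lower[OF x]
      unfolding power2_eq_square by linarith
    then have "cmod (cinner x x) \<le> q x / c" using c by (simp add: field_simps)
    then have "\<bar>l\<bar> * cmod (cinner x x) \<le> \<bar>l\<bar> * (q x / c)" by (intro mult_left_mono) auto
    moreover have "cmod (b x x - of_real l * cinner x x)
        \<le> cmod (a x x) + cmod (v x x) + \<bar>l\<bar> * cmod (cinner x x)"
      using norm_triangle_ineq4[of "b x x" "of_real l * cinner x x"] norm_triangle_ineq[of "a x x" "v x x"]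
      by (simp add: b x norm_mult)
    ultimately show ?thesis using v_le[OF x] by (simp add: algebra_simps)
  qed
  have b_coercive: "\<exists>e>0. \<forall>x\<in>D. e * q x \<le> Re (b (J x) x - of_real l * cinner (J x) x)"
    if l: "- m_minus < ereal l" "ereal l < m_plus" and m_pos: "0 < m_minus" "0 < m_plus" for l
  proof -
    have "- ereal l < m_minus" using l(1) by (rule iffD1[OF ereal_uminus_less_reorder])
    \<comment> \<open>The bounds \<open>m_minus\<close> and \<open>m_plus\<close> may be infinite,
      so reals \<open>r\<close> and \<open>p\<close> below them take their place. They are positive,
      to allow division, and exceed \<open>- l\<close> and \<open>l\<close>, so that both ratios in
      \<open>e\<close> stay below 1.\<close>
    then have "max (ereal (- l)) 0 < m_minus" using m_pos by simp
    then obtain r where r: "max (ereal (- l)) 0 < ereal r" "ereal r < m_minus"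
      using ereal_dense2 by blast
    have "max (ereal l) 0 < m_plus" using m_pos l by simp
    then obtain p where p: "max (ereal l) 0 < ereal p" "ereal p < m_plus"
      using ereal_dense2 by blast
    have pr: "p > 0" "l < p" "r > 0" "- l < r" using p(1) r(1) by simp_all
    \<comment> \<open>\<open>1 - e\<close> is the share of \<open>q x\<close> that the term with
      \<open>l\<close> can consume. It is nonnegative because one of the two ratios is, whichever
      sign \<open>l\<close> has.\<close>
    define e where "e = 1 - max (l / p) (- l / r)"
    have e: "e > 0" "l \<le> (1 - e) * p" "- l \<le> (1 - e) * r"
      using pr by (simp_all add: e_def field_simps max_def)
    have "1 - e \<ge> 0" using pr
      by (cases "l \<ge> 0") (simp_all add: e_def le_max_iff_disj divide_nonpos_pos)
    have J_scaleR: "J (t *\<^sub>R x) = t *\<^sub>R J x" for t x by (simp add: scaleR_scaleC J)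
    have cone_plus: "t *\<^sub>R y \<in> range (\<lambda>x. x + J x)" if "y \<in> range (\<lambda>x. x + J x)" for t y
      using that by (auto simp: scaleR_add_right simp flip: J_scaleR)
    have cone_minus: "t *\<^sub>R y \<in> range (\<lambda>x. x - J x)" if "y \<in> range (\<lambda>x. x - J x)" for t y
      using that by (auto simp: scaleR_diff_right simp flip: J_scaleR)
    have "e * q x \<le> Re (b (J x) x - of_real l * cinner (J x) x)" if x: "x \<in> D" for x
    proof -
      note Jx = J_mem[OF x]
      have "v (J x) x = - cnj (v (J x) x)"
        using v_off_diagonal v x Jx unfolding off_diagonal_def symmetric_form_def by metis
      then have "Re (v (J x) x) = 0" by (simp add: complex_eq_iff)
      then have Re_b: "Re (b (J x) x) = q x" by (simp add: b x Jx a_J_commute s)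
      \<comment> \<open>The vectors \<open>x + J x\<close> and \<open>x - J x\<close> are twice the
        components of \<open>x\<close>, hence the factors 4 below: the difference of their squared
        norms gives \<open>cinner (J x) x\<close> by polarisation, the sum of their \<open>q\<close>
        gives \<open>q x\<close> by the parallelogram law.\<close>
      have l_le: "l * (norm (x + J x))\<^sup>2 \<le> (1 - e) * p * (norm (x + J x))\<^sup>2"
        by (intro mult_right_mono e) simp
      have "p * (norm (x + J x))\<^sup>2 \<le> q (x + J x)"
        by (rule lower_bound_onD[OF _ _ cone_plus]) (use p x Jx in \<open>auto simp: mem m_plus s_def\<close>)
      from mult_left_mono[OF this \<open>1 - e \<ge> 0\<close>]
      have "(1 - e) * p * (norm (x + J x))\<^sup>2 \<le> (1 - e) * q (x + J x)"
        unfolding mult.assoc .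
      with l_le have plus: "l * (norm (x + J x))\<^sup>2 \<le> (1 - e) * q (x + J x)"
        by (rule order_trans)
      have l_le: "- l * (norm (x - J x))\<^sup>2 \<le> (1 - e) * r * (norm (x - J x))\<^sup>2"
        by (intro mult_right_mono e) simp
      have "r * (norm (x - J x))\<^sup>2 \<le> q (x - J x)"
        by (rule lower_bound_onD[OF _ _ cone_minus]) (use r x Jx in \<open>auto simp: mem m_minus s_def\<close>)
      from mult_left_mono[OF this \<open>1 - e \<ge> 0\<close>]
      have "(1 - e) * r * (norm (x - J x))\<^sup>2 \<le> (1 - e) * q (x - J x)"
        unfolding mult.assoc .
      with l_le have "- l * (norm (x - J x))\<^sup>2 \<le> (1 - e) * q (x - J x)"
        by (rule order_trans)
      with plus have "l * ((norm (x + J x))\<^sup>2 - (norm (x - J x))\<^sup>2)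
          \<le> (1 - e) * (q (x + J x) + q (x - J x))"
        unfolding right_diff_distrib distrib_left by simp
      also have "(norm (x + J x))\<^sup>2 - (norm (x - J x))\<^sup>2 = 4 * Re (cinner (J x) x)"
        using hilbert.Re_commute[of x "J x"]
        by (simp add: hilbert.q_add hilbert.q_diff flip: Re_cinner_self)
      also have "q (x + J x) + q (x - J x) = 4 * q x"
        by (simp add: q_add[OF x Jx] q_diff[OF x Jx] q_J x)
      finally have "l * (4 * Re (cinner (J x) x)) \<le> (1 - e) * (4 * q x)" .
      then show ?thesis by (simp add: Re_b algebra_simps)
    qed
    with e show ?thesis by blast
  qed
  \<comment> \<open>The lower bound \<open>c\<close> of the whole form bounds the infimum over any
    \<open>H\<close>, also an empty one.\<close>
  have "ereal c \<le> lower_bound_on H D s" for H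
    unfolding lower_bound_on_def using lower by (intro INF_greatest) force
  then have "0 < lower_bound_on H D s" for H
    using c by (meson ereal_less(2) less_le_trans)
  then have m_pos: "0 < m_minus" "0 < m_plus" by (simp_all add: m_minus m_plus s_def)
  have solve: "\<exists>R. bounded_clinear R \<and>
      (\<forall>f y. R f = y \<longleftrightarrow> y \<in> D \<and> (\<forall>x\<in>D. b x y - of_real l * cinner x y = cinner x f))"
    if l: "- m_minus < ereal l" "ereal l < m_plus" for l
  proof -
    obtain e where "e > 0" "\<And>x. x \<in> D \<Longrightarrow> e * q x \<le> Re (b (J x) x - of_real l * cinner (J x) x)"
      using b_coercive[OF l m_pos] by blast
    then show ?thesis
      by (intro twisted_coercive_solution[OF b_symmetric b_bounded _ _ lower c, where J = J and e = e])
        (auto simp: J J_mem q_J)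
  qed
  have zero: "- m_minus < ereal 0" "ereal 0 < m_plus"
    using m_pos by (simp_all add: ereal_uminus_less_reorder flip: zero_ereal_def)
  obtain R where R: "R f = y \<longleftrightarrow> y \<in> D \<and> (\<forall>x\<in>D. b x y = cinner x f)" for f y
    using solve[OF zero] by auto
  have b_symmetric0: "symmetric_form D b" using b_symmetric[of 0] by simp
  note rep = representing_operator[OF b_symmetric0 D_dense R]
  have resolvent: "of_real l \<in> resolvent_set B"
    if B: "represents_form B D b" and l: "- m_minus < ereal l" "ereal l < m_plus" for B l
  proof -
    \<comment> \<open>Being the inverse of \<open>R\<close>, \<open>B\<close> contains every pair
      that satisfies the weak equation. Hence \<open>S f\<close>, known only as a weak solution of
      the shifted equation, lies in the domain of \<open>B\<close>, with value
      \<open>f + of_real l *\<^sub>C S f\<close>.\<close>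
    have B: "B y = Some f \<longleftrightarrow> y \<in> D \<and> (\<forall>x\<in>D. b x y = cinner x f)" for y f
      using B R unfolding rep(1) by metis
    obtain S where S: "bounded_clinear S"
      "\<And>f y. S f = y \<longleftrightarrow> y \<in> D \<and> (\<forall>x\<in>D. b x y - of_real l * cinner x y = cinner x f)"
      using solve[OF l] by blast
    have "B (S f) = Some (f + of_real l *\<^sub>C S f)" for f
      using S(2)[of f "S f"] unfolding B by (auto simp: hilbert.sesq algebra_simps)
    then have "op_minus_scalar B (of_real l) (S f) = Some f" for f
      by (simp add: op_minus_scalar_def)
    moreover have "S (g - of_real l *\<^sub>C y) = y" if "B y = Some g" for y g
      using that unfolding B S(2) by (simp add: hilbert.sesq)
    ultimately show ?thesis
      unfolding resolvent_set_def boundedly_invertible_def using S(1)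
      by (auto intro!: exI[of _ S] simp: op_minus_scalar_def)
  qed
  have invertible: "boundedly_invertible B" if "represents_form B D b" for B
    using resolvent[OF that zero] by (simp add: resolvent_set_def op_minus_scalar_def option.map_ident)
  have "- m_minus < 0" using zero(1) by (simp add: zero_ereal_def)
  then show ?thesis
    using rep(2) m_pos(2) invertible resolvent by blast
qed

end
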